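(* Let $q\ge0$, $t\ge1$, $k\ge1$ be integers and $Q_k=1+q+q^2+\dots+q^k$. If $\gcd(t,Q_k)=1$ then the critical group $K(\widetilde{W_k(q,t)})$ is cyclic. Otherwise, letting $d_1=\gcd(t,Q_k)$, one has $K(\widetilde{W_k(q,t)})\cong\mathbb{Z}/d_1\mathbb{Z}\times\mathbb{Z}/d_1d_2\mathbb{Z}$ for some positive integer $d_2$.
   Context: $W_{k+1}(q,t)$ is the directed multigraph with hub $v_0$ and rim vertices $v_1,\dots,v_{k+1}$ (clockwise, indices mod $k+1$), with $t$ edges each way between $v_0$ and each $v_i$, one edge $v_i\to v_{i-1}$ and $q$ edges $v_i\to v_{i+1}$. The graph $\widetilde{W_k(q,t)}$ is obtained from $W_{k+1}(q,t)$ by removing all edges (spokes) between $v_0$ and $v_1$. Its critical group $K(\widetilde{W_k(q,t)})$ (dollar game with bank $v_0$) is isomorphic to the cokernel $\mathbb{Z}^{k+1}/L\mathbb{Z}^{k+1}$ of its reduced Laplacian $L$ (the Laplacian with row and column of $v_0$ deleted; $L_{ii}$ is the out-degree of $v_i$ and $L_{ij}=-\#\{\text{edges } v_i\to v_j\}$ for $i\ne j$). *)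

theory Defs
  imports
    Complex_Main
    "HOL-Algebra.Elementary_Groups"
    "HOL-Algebra.Product_Groups"
    "Graph_Theory.Digraph"
begin

definition arc_count :: "('a, 'b) pre_digraph \<Rightarrow> 'a \<Rightarrow> 'a \<Rightarrow> nat" where
  "arc_count G u v = card {e \<in> arcs G. tail G e = u \<and> head G e = v}"

definition laplacian :: "('a, 'b) pre_digraph \<Rightarrow> 'a \<Rightarrow> 'a \<Rightarrow> int" where
  "laplacian G u v = (if u = v then int (out_degree G u) else - int (arc_count G u v))"

text \<open>The free abelian group of integer vectors with coordinates indexed by \<^term>\<open>I\<close>.\<close>

definition int_vectors :: "'a set \<Rightarrow> ('a \<Rightarrow> int) monoid" where
  "int_vectors I = product_group I (\<lambda>_. integer_group)"

definition matrix_image :: "'a set \<Rightarrow> ('a \<Rightarrow> 'a \<Rightarrow> int) \<Rightarrow> ('a \<Rightarrow> int) set" where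
  "matrix_image I L = (\<lambda>x. \<lambda>i\<in>I. \<Sum>j\<in>I. L i j * x j) ` carrier (int_vectors I)"

text \<open>
  The critical group with bank \<^term>\<open>b\<close>, presented as the cokernel of the reduced Laplacian:
  deleting the row and column of \<^term>\<open>b\<close> amounts to restricting the index set to the
  other vertices.
\<close>

definition critical_group :: "('a, 'b) pre_digraph \<Rightarrow> 'a \<Rightarrow> ('a \<Rightarrow> int) set monoid" where
  "critical_group G b =
     int_vectors (verts G - {b}) Mod matrix_image (verts G - {b}) (laplacian G)"

text \<open>
  The hub of the wheel with \<^term>\<open>n\<close> rim vertices is \<^term>\<open>0::nat\<close>, the rim vertices are
  \<^term>\<open>1::nat\<close>, ..., \<^term>\<open>n\<close> in clockwise order. The last argument of an arc numbers
  parallel copies. In particular, for \<^prop>\<open>n = 2\<close> the forward and the backward arcs out of a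
  rim vertex have the same head but remain different arcs.
\<close>

datatype wheel_arc =
    From_Hub nat nat
  | To_Hub nat nat
  | Backward nat
  | Forward nat nat

definition rim_next :: "nat \<Rightarrow> nat \<Rightarrow> nat" where
  "rim_next n i = (if i = n then 1 else i + 1)"

definition rim_prev :: "nat \<Rightarrow> nat \<Rightarrow> nat" where
  "rim_prev n i = (if i = 1 then n else i - 1)"

fun wheel_tail :: "wheel_arc \<Rightarrow> nat" where
  "wheel_tail (From_Hub i c) = 0"
| "wheel_tail (To_Hub i c) = i"
| "wheel_tail (Backward i) = i"
| "wheel_tail (Forward i c) = i"

fun wheel_head :: "nat \<Rightarrow> wheel_arc \<Rightarrow> nat" where
  "wheel_head n (From_Hub i c) = i"
| "wheel_head n (To_Hub i c) = 0"
| "wheel_head n (Backward i) = rim_prev n i"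
| "wheel_head n (Forward i c) = rim_next n i"

definition wheel :: "nat \<Rightarrow> nat \<Rightarrow> nat \<Rightarrow> (nat, wheel_arc) pre_digraph" where
  "wheel n q t =
     \<lparr> verts = {0..n},
       arcs = {From_Hub i c | i c. i \<in> {1..n} \<and> c < t}
            \<union> {To_Hub i c | i c. i \<in> {1..n} \<and> c < t}
            \<union> {Backward i | i. i \<in> {1..n}}
            \<union> {Forward i c | i c. i \<in> {1..n} \<and> c < q},
       tail = wheel_tail,
       head = wheel_head n \<rparr>"

definition wheel_tilde :: "nat \<Rightarrow> nat \<Rightarrow> nat \<Rightarrow> (nat, wheel_arc) pre_digraph" where
  "wheel_tilde k q t =
     (let G = wheel (k + 1) q t
      in G \<lparr> arcs := {e \<in> arcs G. {tail G e, head G e} \<noteq> {0, 1}} \<rparr>)"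

end

theory Submission
  imports Defs "HOL-Computational_Algebra.Primes"
begin

text \<open>
  Solving \<open>L y = x\<close> row by row along the rim eliminates all unknowns but two, so the cokernel of \<open>L\<close>
  is the cokernel of a symmetric \<open>2 \<times> 2\<close> integer matrix with rows \<open>(\<alpha>, -\<beta>)\<close> and
  \<open>(-\<beta>, (1 + q) \<beta> + q t u - q \<alpha>)\<close>. Here \<open>\<alpha> = A\<^sub>k\<^sub>+\<^sub>1\<close>, \<open>u = A\<^sub>k\<close> and \<open>\<beta> = 1 + q u\<close> for the sequence
  \<open>A\<^sub>0 = 0\<close>, \<open>A\<^sub>1 = 1\<close>, \<open>A\<^sub>j\<^sub>+\<^sub>2 = (1 + q + t) A\<^sub>j\<^sub>+\<^sub>1 - q A\<^sub>j\<close>. A common divisor of the entries divides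
  \<open>q t u = t (\<beta> - 1)\<close>, hence \<open>t\<close>; and \<open>\<alpha>\<close> and \<open>\<beta>\<close> are both congruent to \<open>Q\<^sub>k\<close> modulo \<open>t\<close>. So the gcd of
  the entries is \<open>gcd t Q\<^sub>k\<close>, and the Smith normal form gives the group. The determinant
  \<open>(1 + q) \<alpha> - 2 q u - q^(k+1) - 1\<close> is positive because \<open>A\<close> grows fast enough.
\<close>

section \<open>Smith normal form of integer 2 x 2 matrices\<close>

lemma exists_coprime_row_combination:
  fixes a b c d :: int
  assumes det: "a * d - b * c \<noteq> 0" and gcd1: "gcd (gcd a b) (gcd c d) = 1"
  shows "\<exists>y. coprime (a + y * c) (b + y * d)"
proof -
  \<comment> \<open>Only prime divisors of the determinant can divide both entries. Such a prime \<open>p\<close> does not if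
    \<open>y\<close> is divisible by \<open>p\<close> exactly when \<open>p\<close> fails to divide one of \<open>a\<close>, \<open>b\<close>.\<close>
  define P where "P = {p. prime p \<and> p dvd a * d - b * c \<and> \<not> (p dvd a \<and> p dvd b)}"
  define y where "y = \<Prod>P"
  have "P \<subseteq> {p. p dvd a * d - b * c}"
    by (auto simp: P_def)
  then have fin: "finite P"
    using det finite_divisors_int finite_subset by blast
  have "coprime (a + y * c) (b + y * d)"
  proof (rule ccontr)
    assume "\<not> coprime (a + y * c) (b + y * d)"
    then have "gcd (a + y * c) (b + y * d) \<noteq> 1"
      by (simp add: coprime_iff_gcd_eq_1)
    moreover have "a + y * c \<noteq> 0 \<or> b + y * d \<noteq> 0"
    proof (rule ccontr)
      assume "\<not> (a + y * c \<noteq> 0 \<or> b + y * d \<noteq> 0)"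
      then have "a = - y * c" "b = - y * d" by auto
      then have "a * d - b * c = 0" by simp
      with det show False by simp
    qed
    ultimately obtain p where p: "prime p" "p dvd gcd (a + y * c) (b + y * d)"
      using prime_divisor_exists[of "gcd (a + y * c) (b + y * d)"] by auto
    then have p1: "p dvd a + y * c" and p2: "p dvd b + y * d" by auto
    have "a * d - b * c = (a + y * c) * d - (b + y * d) * c" by algebra
    then have pdet: "p dvd a * d - b * c"
      using p1 p2 by (simp add: dvd_diff)
    show False
    proof (cases "p dvd a \<and> p dvd b")
      case True
      have "\<not> p dvd y"
      proof
        assume "p dvd y"
        then obtain r where "r \<in> P" "p dvd r"
          unfolding y_def using prime_dvd_prod_iff[OF fin p(1), of "\<lambda>x. x"] by auto
        then have "p = r" using p(1) primes_dvd_imp_eq by (auto simp: P_def)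
        with \<open>r \<in> P\<close> True show False by (auto simp: P_def)
      qed
      moreover have "p dvd y * c" "p dvd y * d"
        using True p1 p2 dvd_add_right_iff by blast+
      ultimately have "p dvd c" "p dvd d"
        using p(1) prime_dvd_mult_iff by blast+
      with True have "p dvd gcd (gcd a b) (gcd c d)" by simp
      with gcd1 p(1) show False by (simp add: not_prime_unit)
    next
      case False
      then have "p \<in> P" using p(1) pdet by (auto simp: P_def)
      then have "p dvd y" unfolding y_def using fin by (rule dvd_prodI[rotated])
      then have "p dvd a" "p dvd b"
        using p1 p2 by (metis dvd_add_left_iff dvd_mult2)+
      with False show False by simp
    qed
  qed
  then show ?thesis ..
qed

text \<open>Adding \<open>y\<close> times the second row to the first makes the first row coprime.
  Clearing the second row against it leaves a multiple of the determinant, so the normal form is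
  diag(1, det).\<close>

lemma primitive_image_2x2:
  fixes a b c d :: int
  assumes det: "a * d - b * c \<noteq> 0" and gcd1: "gcd (gcd a b) (gcd c d) = 1"
  obtains x y z w :: int where "x * w - y * z = 1"
    "\<And>v1 v2. (\<exists>p r. v1 = a * p + b * r \<and> v2 = c * p + d * r) \<longleftrightarrow>
       a * d - b * c dvd z * v1 + w * v2"
proof -
  obtain y where "coprime (a + y * c) (b + y * d)"
    using exists_coprime_row_combination[OF assms] by blast
  then obtain al be where bez: "(a + y * c) * al + (b + y * d) * be = 1"
    by (metis bezout_int coprime_iff_gcd_eq_1 mult.commute)
  define D where "D = a * d - b * c"
  \<comment> \<open>\<open>\<kappa>\<close> pairs the row \<open>(c, d)\<close> with the Bezout
    vector \<open>(al, be)\<close>. Subtracting \<open>\<kappa>\<close> times the coprime row gives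
    a row orthogonal to that vector, hence a multiple of \<open>(- be, al)\<close>; the factor is
    \<open>D\<close>.\<close>
  define \<kappa> where "\<kappa> = c * al + d * be"
  define z where "z = - \<kappa>"
  define w where "w = 1 - \<kappa> * y"
  have uni: "1 * w - y * z = 1" by (simp add: z_def w_def)
  have row2: "z * a + w * c = - D * be" "z * b + w * d = D * al"
    using bez unfolding z_def w_def \<kappa>_def D_def by algebra+
  have "(\<exists>p r. v1 = a * p + b * r \<and> v2 = c * p + d * r) \<longleftrightarrow> D dvd z * v1 + w * v2" for v1 v2
  proof
    assume "\<exists>p r. v1 = a * p + b * r \<and> v2 = c * p + d * r"
    then obtain p r where v: "v1 = a * p + b * r" "v2 = c * p + d * r" by blast
    have "z * v1 + w * v2 = (z * a + w * c) * p + (z * b + w * d) * r"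
      unfolding v by algebra
    also have "\<dots> = D * (al * r - be * p)" unfolding row2 by algebra
    finally show "D dvd z * v1 + w * v2" by simp
  next
    assume "D dvd z * v1 + w * v2"
    then obtain h where h: "z * v1 + w * v2 = D * h" by blast
    define e where "e = v1 + y * v2"
    \<comment> \<open>\<open>(p, r)\<close> is the image of \<open>(e, h)\<close> under the inverse
      of the unimodular matrix with rows \<open>(a + y * c, b + y * d)\<close> and
      \<open>(- be, al)\<close>.\<close>
    define p where "p = al * e - (b + y * d) * h"
    define r where "r = be * e + (a + y * c) * h"
    have "v1 = w * e - y * (D * h)" "v2 = D * h - z * e"
      using uni unfolding h[symmetric] e_def by algebra+
    then have "v1 = a * p + b * r" "v2 = c * p + d * r"
      using bez row2 uni unfolding p_def r_def D_def z_def w_def \<kappa>_def by algebra+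
    then show "\<exists>p r. v1 = a * p + b * r \<and> v2 = c * p + d * r" by blast
  qed
  with uni that show ?thesis unfolding D_def by blast
qed

text \<open>Dividing by \<open>g\<close> reduces to the primitive case, and \<open>m\<close> is the
  absolute value of the remaining determinant. Unimodularity turns "\<open>g\<close> divides
  \<open>v1\<close> and \<open>v2\<close>" into the same condition on the new coordinates; for the
  second it follows from the stronger one modulo \<open>g * m\<close>.\<close>

lemma smith_normal_form_2x2:
  fixes a b c d :: int
  assumes det: "a * d - b * c \<noteq> 0" and g: "g = gcd (gcd a b) (gcd c d)"
  obtains x y z w :: int and m :: nat where "x * w - y * z = 1" "m > 0"
    "\<And>v1 v2. (\<exists>p r. v1 = a * p + b * r \<and> v2 = c * p + d * r) \<longleftrightarrow>
       g dvd x * v1 + y * v2 \<and> g * int m dvd z * v1 + w * v2"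
proof -
  have g0: "g \<noteq> 0" using det g by auto
  have "g dvd a" "g dvd b" "g dvd c" "g dvd d"
    unfolding g by (meson dvd_trans gcd_dvd1 gcd_dvd2)+
  then obtain a' b' c' d' where abcd: "a = g * a'" "b = g * b'" "c = g * c'" "d = g * d'"
    by (auto elim!: dvdE)
  have "g = g * gcd (gcd a' b') (gcd c' d')"
    using g unfolding abcd by (metis abs_gcd_int abs_mult gcd_mult_distrib_int)
  then have gcd1: "gcd (gcd a' b') (gcd c' d') = 1" using g0 by (metis mult_cancel_left1)
  have "a * d - b * c = g * g * (a' * d' - b' * c')" unfolding abcd by algebra
  then have det': "a' * d' - b' * c' \<noteq> 0" using det by auto
  obtain x y z w where uni: "x * w - y * z = 1" and
    im: "\<And>v1 v2. (\<exists>p r. v1 = a' * p + b' * r \<and> v2 = c' * p + d' * r) \<longleftrightarrow>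
       a' * d' - b' * c' dvd z * v1 + w * v2"
    using primitive_image_2x2[OF det' gcd1] by metis
  define D where "D = a' * d' - b' * c'"
  have "(\<exists>p r. v1 = a * p + b * r \<and> v2 = c * p + d * r) \<longleftrightarrow>
       g dvd x * v1 + y * v2 \<and> g * D dvd z * v1 + w * v2" (is "?L \<longleftrightarrow> ?R") for v1 v2
  proof -
    have dist: "g * i * p + g * j * r = g * (i * p + j * r)" for i j p r by algebra
    have "?L \<longleftrightarrow> (\<exists>u1 u2. v1 = g * u1 \<and> v2 = g * u2 \<and>
        (\<exists>p r. u1 = a' * p + b' * r \<and> u2 = c' * p + d' * r))"
      unfolding abcd dist by blast
    also have "\<dots> \<longleftrightarrow> (\<exists>u1 u2. v1 = g * u1 \<and> v2 = g * u2 \<and> D dvd z * u1 + w * u2)"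
      unfolding im D_def ..
    also have "\<dots> \<longleftrightarrow> (\<exists>u1 u2. v1 = g * u1 \<and> v2 = g * u2 \<and> g * D dvd z * v1 + w * v2)"
    proof -
      have "g * D dvd z * (g * u1) + w * (g * u2) \<longleftrightarrow> D dvd z * u1 + w * u2" for u1 u2
      proof -
        have "z * (g * u1) + w * (g * u2) = g * (z * u1 + w * u2)" by algebra
        then show ?thesis using g0 by simp
      qed
      then show ?thesis by blast
    qed
    also have "\<dots> \<longleftrightarrow> g dvd v1 \<and> g dvd v2 \<and> g * D dvd z * v1 + w * v2"
      by (auto elim!: dvdE)
    also have "\<dots> \<longleftrightarrow> ?R"
    proof -
      have "v1 = w * (x * v1 + y * v2) - y * (z * v1 + w * v2)"
        "v2 = x * (z * v1 + w * v2) - z * (x * v1 + y * v2)" using uni by algebra+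
      then have "g dvd v1 \<and> g dvd v2"
        if "g dvd x * v1 + y * v2" "g dvd z * v1 + w * v2"
        using that by (metis dvd_diff dvd_mult)
      then show ?thesis by (auto intro: dvd_mult_left)
    qed
    finally show ?thesis .
  qed
  moreover have "g * int (nat \<bar>D\<bar>) dvd e \<longleftrightarrow> g * D dvd e" for e
    by (cases "D \<ge> 0") auto
  ultimately have "(\<exists>p r. v1 = a * p + b * r \<and> v2 = c * p + d * r) \<longleftrightarrow>
       g dvd x * v1 + y * v2 \<and> g * int (nat \<bar>D\<bar>) dvd z * v1 + w * v2" for v1 v2
    by (simp only:)
  moreover have "nat \<bar>D\<bar> > 0" using det' by (simp add: D_def)
  ultimately show ?thesis by (rule that[OF uni, rotated])
qed

section \<open>Quotients cut out by two congruences\<close>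

text \<open>First isomorphism theorem for the reduction of \<open>(f, h)\<close> modulo
  \<open>(m, n)\<close>, whose kernel is \<open>K\<close>.\<close>

lemma quotient_by_congruences:
  fixes G (structure) and f h :: "'a \<Rightarrow> int" and m n :: nat
  assumes G: "group G" and pos: "m > 0" "n > 0"
    and f: "\<And>x y. x \<in> carrier G \<Longrightarrow> y \<in> carrier G \<Longrightarrow> f (x \<otimes> y) = f x + f y"
    and h: "\<And>x y. x \<in> carrier G \<Longrightarrow> y \<in> carrier G \<Longrightarrow> h (x \<otimes> y) = h x + h y"
    and surj: "\<And>a b. \<exists>x\<in>carrier G. f x = a \<and> h x = b"
    and K: "K = {x \<in> carrier G. int m dvd f x \<and> int n dvd h x}"
  shows "group (G Mod K)" and "G Mod K \<cong> integer_mod_group m \<times>\<times> integer_mod_group n"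
proof -
  define H where "H = integer_mod_group m \<times>\<times> integer_mod_group n"
  define \<phi> where "\<phi> = (\<lambda>x. (f x mod int m, h x mod int n))"
  have H: "group H" unfolding H_def by (intro DirProd_group) simp_all
  have carH: "carrier H = {0..<int m} \<times> {0..<int n}"
    using pos by (simp add: H_def DirProd_def carrier_integer_mod_group)
  have "\<phi> \<in> hom G H"
    using pos
    by (auto simp: hom_def carrier_integer_mod_group \<phi>_def H_def DirProd_def f h mod_add_eq)
  then interpret group_hom G H \<phi>
    using G H by (simp add: group_hom_def group_hom_axioms_def)
  have ker: "kernel G H \<phi> = K"
    by (auto simp: kernel_def K \<phi>_def H_def DirProd_def)
  have "\<phi> ` carrier G = carrier H"
  proof
    show "\<phi> ` carrier G \<subseteq> carrier H" by auto
    show "carrier H \<subseteq> \<phi> ` carrier G"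
    proof
      fix v assume "v \<in> carrier H"
      then obtain a b where v: "v = (a, b)" "0 \<le> a" "a < int m" "0 \<le> b" "b < int n"
        unfolding carH by auto
      obtain x where "x \<in> carrier G" "f x = a" "h x = b" using surj by blast
      moreover from this v have "\<phi> x = v" by (simp add: \<phi>_def)
      ultimately show "v \<in> \<phi> ` carrier G" by blast
    qed
  qed
  from FactGroup_iso[OF this] show "G Mod K \<cong> integer_mod_group m \<times>\<times> integer_mod_group n"
    unfolding ker by (simp only: H_def)
  show "group (G Mod K)"
    using normal.factorgroup_is_group[OF normal_kernel] unfolding ker .
qed

lemma cyclic_group_trivial_times_integer_mod_group:
  assumes "n > 0"
  shows "cyclic_group (integer_mod_group 1 \<times>\<times> integer_mod_group n)"
proof (rule group.cyclic_group_epimorphic_image)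
  show "(\<lambda>i. (0, i mod int n)) \<in> epi integer_group (integer_mod_group 1 \<times>\<times> integer_mod_group n)"
    using assms
    by (auto simp: epi_def hom_def DirProd_def carrier_integer_mod_group integer_group_def
        mod_add_eq image_iff intro!: exI mod_pos_pos_trivial[symmetric])
qed (auto intro: DirProd_group)

section \<open>Second order linear recurrences\<close>

text \<open>A row of \<open>L y = x\<close> away from vertex 1, solved for the unknown at the
  preceding vertex, has this form; \<open>w\<close> lists the entries of \<open>x\<close> backwards
  along the rim, hence the minus sign.\<close>

fun recurrence :: "int \<Rightarrow> int \<Rightarrow> (nat \<Rightarrow> int) \<Rightarrow> int \<Rightarrow> int \<Rightarrow> nat \<Rightarrow> int" where
  "recurrence s q w y0 y1 0 = y0"
| "recurrence s q w y0 y1 (Suc 0) = y1"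
| "recurrence s q w y0 y1 (Suc (Suc j)) =
     s * recurrence s q w y0 y1 (Suc j) - q * recurrence s q w y0 y1 j - w j"

abbreviation fundamental :: "int \<Rightarrow> int \<Rightarrow> nat \<Rightarrow> int" where
  "fundamental s q \<equiv> recurrence s q (\<lambda>_. 0) 0 1"

abbreviation particular :: "int \<Rightarrow> int \<Rightarrow> (nat \<Rightarrow> int) \<Rightarrow> nat \<Rightarrow> int" where
  "particular s q w \<equiv> recurrence s q w 0 0"

text \<open>The homogeneous solution with initial values 1, 0 is \<open>- q\<close> times the
  fundamental one delayed by one index; starting at \<open>Suc j\<close> avoids index -1.\<close>

lemma recurrence_superposition:
  "recurrence s q w y0 y1 (Suc j) =
     y1 * fundamental s q (Suc j) - q * y0 * fundamental s q j + particular s q w (Suc j)"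
proof (induction s q w y0 y1 j rule: recurrence.induct)
  case (3 s q w y0 y1 j)
  have "fundamental s q (Suc (Suc j)) = s * fundamental s q (Suc j) - q * fundamental s q j"
    by simp
  moreover have "v (Suc (Suc (Suc j))) = s * v (Suc (Suc j)) - q * v (Suc j) - w (Suc j)"
    if "v = recurrence s q w y0 y1" for w v y0 y1
    unfolding that by (rule recurrence.simps)
  note this[OF refl, of w y0 y1] this[OF refl, of w 0 0] this[OF refl, of "\<lambda>_. 0" 0 1]
  ultimately show ?case
    using 3 by algebra
qed simp_all

lemma particular_add:
  "particular s q (\<lambda>i. v i + w i) j = particular s q v j + particular s q w j"
  by (induction s q v "0::int" "0::int" j rule: recurrence.induct) (simp_all add: algebra_simps)

text \<open>With \<open>w j = x (Suc k - j)\<close>, the values up to index \<open>Suc k\<close>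
  involve only the coordinates 2 to \<open>Suc k\<close> of \<open>x\<close>, all inside the index
  set.\<close>

lemma particular_cong:
  assumes "\<And>i. i + 2 \<le> j \<Longrightarrow> v i = w i"
  shows "particular s q v j = particular s q w j"
  using assms
  by (induction s q v "0::int" "0::int" j rule: recurrence.induct) simp_all

lemma particular_zero: "particular s q (\<lambda>_. 0) j = 0"
  by (induction s q "\<lambda>_::nat. 0::int" "0::int" "0::int" j rule: recurrence.induct) simp_all

lemma recurrence_unique:
  assumes "z 0 = y0" "z (Suc 0) = y1"
    and "\<And>j. j + 2 \<le> n \<Longrightarrow> z (Suc (Suc j)) = s * z (Suc j) - q * z j - w j"
    and "j \<le> n"
  shows "z j = recurrence s q w y0 y1 j"
  using assms(4)
proof (induction j rule: induct_nat_012)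
  case (ge2 j)
  then show ?case using assms(3)[of j] by simp
qed (use assms(1,2) in simp_all)

text \<open>A Cassini identity: each step multiplies this quadratic form by \<open>q\<close>, the
  determinant of the companion matrix.\<close>

lemma fundamental_invariant:
  "fundamental s q (Suc j) ^ 2 - s * fundamental s q (Suc j) * fundamental s q j
     + q * fundamental s q j ^ 2 = q ^ j"
proof (induction j)
  case (Suc j)
  have "(s * a - q * b) ^ 2 - s * (s * a - q * b) * a + q * a ^ 2
      = q * (a ^ 2 - s * a * b + q * b ^ 2)" for a b :: int
    by algebra
  then show ?case using Suc by simp
qed simp

text \<open>The differences \<open>A (Suc j) - q * A j\<close> and \<open>A (Suc j) - A j\<close>
  pass to the next index by adding \<open>t * A (Suc j)\<close>, the second after multiplication by
  \<open>q\<close>. The bounds are proved jointly since each step needs the signs of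
  \<open>A\<close>.\<close>

lemma fundamental_growth:
  fixes q t :: int
  assumes "q \<ge> 0" "t \<ge> 1"
  defines "A \<equiv> fundamental (1 + q + t) q"
  shows "A (Suc j) \<ge> 1 \<and> A j \<ge> 0 \<and> A (Suc j) - q * A j \<ge> 1 + t * A j
    \<and> A (Suc j) - A j \<ge> q ^ j"
proof (induction j)
  case 0
  show ?case by (simp add: A_def)
next
  case (Suc j)
  have step: "A (Suc (Suc j)) = (1 + q + t) * A (Suc j) - q * A j" by (simp add: A_def)
  have ge1: "A (Suc j) \<ge> 1" and ge0: "A j \<ge> 0"
    and w: "A (Suc j) - q * A j \<ge> 1 + t * A j" and z: "A (Suc j) - A j \<ge> q ^ j"
    using Suc by auto
  have tA: "t * A j \<ge> 0" "t * A (Suc j) \<ge> 0" using assms ge0 ge1 by simp_all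
  have w': "A (Suc (Suc j)) - q * A (Suc j) = (A (Suc j) - q * A j) + t * A (Suc j)"
    unfolding step by algebra
  have z': "A (Suc (Suc j)) - A (Suc j) = q * (A (Suc j) - A j) + t * A (Suc j)"
    unfolding step by algebra
  have "q * (A (Suc j) - A j) \<ge> q * q ^ j"
    using z assms(1) by (rule mult_left_mono)
  then have 1: "A (Suc (Suc j)) - A (Suc j) \<ge> q ^ Suc j" using z' tA by simp
  have "q ^ Suc j \<ge> 0" using assms(1) by simp
  with 1 ge1 have "A (Suc (Suc j)) \<ge> 1" by linarith
  moreover have "A (Suc (Suc j)) - q * A (Suc j) \<ge> 1 + t * A (Suc j)"
    using w' w tA by linarith
  ultimately show ?case using 1 ge1 by simp
qed

text \<open>Modulo \<open>t\<close> the characteristic roots are 1 and \<open>q\<close>, so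
  \<open>A (Suc j)\<close> is congruent to \<open>1 + q * A j\<close>, the recursion of the
  geometric sum.\<close>

lemma fundamental_cong_geometric_sum:
  fixes q t :: int
  shows "t dvd fundamental (1 + q + t) q (Suc j) - (\<Sum>i\<le>j. q ^ i)"
proof -
  define A where "A = fundamental (1 + q + t) q"
  have "A (Suc j) = 1 + q * A j + t * (\<Sum>i\<le>j. A i)" for j
  proof (induction j)
    case (Suc j)
    have "A (Suc (Suc j)) = (1 + q + t) * A (Suc j) - q * A j" by (simp add: A_def)
    then show ?case using Suc by (simp add: algebra_simps)
  qed (simp add: A_def)
  note rec = this
  have "t dvd A (Suc j) - (\<Sum>i\<le>j. q ^ i)"
  proof (induction j)
    case (Suc j)
    have "(\<Sum>i\<le>Suc j. q ^ i) = 1 + q * (\<Sum>i\<le>j. q ^ i)"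
      by (subst sum.atMost_Suc_shift) (simp add: sum_distrib_left)
    then have "A (Suc (Suc j)) - (\<Sum>i\<le>Suc j. q ^ i)
        = q * (A (Suc j) - (\<Sum>i\<le>j. q ^ i)) + t * (\<Sum>i\<le>Suc j. A i)"
      using rec[of "Suc j"] by (simp only: algebra_simps)
    then show ?case using Suc by simp
  qed (simp add: A_def)
  then show ?thesis by (simp add: A_def)
qed

section \<open>The reduced Laplacian of the wheel and its image\<close>

lemma verts_wheel_tilde: "verts (wheel_tilde k q t) - {0} = {1..Suc k}"
  by (auto simp: wheel_tilde_def wheel_def Let_def)

lemma out_degree_wheel_tilde:
  assumes "i \<in> {1..Suc k}" "k \<ge> 1"
  shows "out_degree (wheel_tilde k q t) i = (if i = 1 then 1 + q else 1 + q + t)"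
proof -
  have "out_arcs (wheel_tilde k q t) i =
      (if i = 1 then {} else To_Hub i ` {..<t}) \<union> ({Backward i} \<union> Forward i ` {..<q})"
    using assms
    by (auto simp: out_arcs_def wheel_tilde_def wheel_def Let_def rim_prev_def rim_next_def
        doubleton_eq_iff)
  moreover have "card ({Backward i} \<union> Forward i ` {..<q}) = 1 + q"
    by (subst card_Un_disjoint) (auto simp: card_image inj_on_def)
  moreover have "card (To_Hub i ` {..<t} \<union> ({Backward i} \<union> Forward i ` {..<q}))
      = t + card ({Backward i} \<union> Forward i ` {..<q})"
    by (subst card_Un_disjoint) (auto simp: card_image inj_on_def)
  ultimately show ?thesis
    unfolding out_degree_def by (cases "i = 1") (simp_all only: if_True if_False Un_empty_left, simp)
qed

text \<open>A sum of indicators, because for \<open>k = 1\<close> the two rim neighbours coincide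
  and their arcs add up.\<close>

lemma arc_count_wheel_tilde:
  assumes "i \<in> {1..Suc k}" "j \<in> {1..Suc k}"
  shows "arc_count (wheel_tilde k q t) i j =
    of_bool (j = rim_prev (Suc k) i) + q * of_bool (j = rim_next (Suc k) i)"
proof -
  have "{e \<in> arcs (wheel_tilde k q t). tail (wheel_tilde k q t) e = i \<and>
        head (wheel_tilde k q t) e = j} =
      (if j = rim_prev (Suc k) i then {Backward i} else {}) \<union>
      (if j = rim_next (Suc k) i then Forward i ` {..<q} else {})"
    using assms
    by (auto simp: wheel_tilde_def wheel_def Let_def doubleton_eq_iff)
  moreover have "card ({Backward i} \<union> Forward i ` {..<q}) = 1 + q"
    by (subst card_Un_disjoint) (auto simp: card_image inj_on_def)
  ultimately show ?thesis
    by (auto simp: arc_count_def card_image inj_on_def)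
qed

lemma laplacian_wheel_tilde_apply:
  fixes y :: "nat \<Rightarrow> int"
  assumes i: "i \<in> {1..Suc k}" and k: "k \<ge> 1"
  shows "(\<Sum>j\<in>{1..Suc k}. laplacian (wheel_tilde k q t) i j * y j) =
    (1 + int q + (if i = 1 then 0 else int t)) * y i
      - y (rim_prev (Suc k) i) - int q * y (rim_next (Suc k) i)"
proof -
  let ?I = "{1..Suc k}" and ?pr = "rim_prev (Suc k) i" and ?nx = "rim_next (Suc k) i"
  have ne: "?pr \<noteq> i" "?nx \<noteq> i" and mem: "?pr \<in> ?I" "?nx \<in> ?I"
    using i k by (auto simp: rim_prev_def rim_next_def)
  have "laplacian (wheel_tilde k q t) i j * y j =
      (if j = i then (1 + int q + (if i = 1 then 0 else int t)) * y j else 0)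
      - (if j = ?pr then y j else 0) - (if j = ?nx then int q * y j else 0)"
    if "j \<in> ?I" for j
    using that i k ne
    by (auto simp: laplacian_def out_degree_wheel_tilde arc_count_wheel_tilde algebra_simps)
  then have "(\<Sum>j\<in>?I. laplacian (wheel_tilde k q t) i j * y j) =
      (\<Sum>j\<in>?I. (if j = i then (1 + int q + (if i = 1 then 0 else int t)) * y j else 0)
      - (if j = ?pr then y j else 0) - (if j = ?nx then int q * y j else 0))"
    by (rule sum.cong[OF refl])
  also have "\<dots> = (1 + int q + (if i = 1 then 0 else int t)) * y i - y ?pr - int q * y ?nx"
    by (simp only: sum_subtractf sum.delta finite_atLeastAtMost i mem if_True)
  finally show ?thesis .
qed

lemma carrier_int_vectors: "carrier (int_vectors I) = (\<Pi>\<^sub>E i\<in>I. UNIV)"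
  by (simp add: int_vectors_def integer_group_def)

lemma mult_int_vectors: "x \<otimes>\<^bsub>int_vectors I\<^esub> y = (\<lambda>i\<in>I. x i + y i)"
  by (simp add: int_vectors_def integer_group_def)

lemma group_int_vectors: "group (int_vectors I)"
  unfolding int_vectors_def by (intro product_group) simp

text \<open>
  Reading the system \<open>L y = x\<close> from the last row to the second one expresses every \<open>y\<^sub>i\<close> through
  \<open>p = y\<^sub>k\<^sub>+\<^sub>1\<close> and \<open>r = y\<^sub>k\<^sub>+\<^sub>2 = y\<^sub>1\<close>: the sequence \<open>j \<mapsto> y\<^sub>k\<^sub>+\<^sub>2\<^sub>-\<^sub>j\<close> solves a second order recurrence.
  What remains are the closing condition on \<open>y\<^sub>1\<close> and the first row.
\<close>

lemma matrix_image_wheel_tilde_iff: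
  fixes q t k :: nat
  assumes k: "k \<ge> 1" and x: "x \<in> carrier (int_vectors {1..Suc k})"
  defines "s \<equiv> 1 + int q + int t"
  defines "A \<equiv> fundamental s (int q)"
    and "D \<equiv> particular s (int q) (\<lambda>j. x (Suc k - j))"
  shows "x \<in> matrix_image {1..Suc k} (laplacian (wheel_tilde k q t)) \<longleftrightarrow>
    (\<exists>p r. - D (Suc k) = A (Suc k) * p + - (1 + int q * A k) * r \<and>
           x 1 + int q * D k = - (1 + int q * A k) * p
             + (1 + int q + int q * s * A k - int q * A (Suc k)) * r)"
    (is "_ \<longleftrightarrow> (\<exists>p r. ?E1 p r \<and> ?E2 p r)")
proof -
  let ?I = "{1..Suc k}" and ?L = "laplacian (wheel_tilde k q t)"
  define w where "w = (\<lambda>j. x (Suc k - j))"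
  \<comment> \<open>The value at \<open>k\<close> involves \<open>A m\<close>; \<open>A_Suc\<close>
    trades it for \<open>A (Suc k)\<close>, which makes the matrix symmetric in the stated
    form.\<close>
  obtain m where m: "k = Suc m" using k by (cases k) auto
  have A_Suc: "A (Suc k) = s * A k - int q * A m" by (simp add: A_def m)
  have sol: "recurrence s (int q) w r p (Suc j) = p * A (Suc j) - int q * r * A j + D (Suc j)"
    for r p j
    unfolding A_def D_def w_def by (rule recurrence_superposition)
  have E1: "?E1 p r \<longleftrightarrow> recurrence s (int q) w r p (Suc k) = r" for p r
    unfolding sol by (auto simp: algebra_simps)
  have E2: "?E2 p r \<longleftrightarrow> x 1 = (1 + int q) * r - p - int q * recurrence s (int q) w r p k" for p r
    unfolding m sol unfolding m[symmetric] A_Suc by (auto simp: algebra_simps)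
  show ?thesis
  proof
    assume "x \<in> matrix_image ?I ?L"
    then obtain y where "x = (\<lambda>i\<in>?I. \<Sum>j\<in>?I. ?L i j * y j)"
      by (auto simp: matrix_image_def)
    then have xi: "x i = (1 + int q + (if i = 1 then 0 else int t)) * y i
      - y (rim_prev (Suc k) i) - int q * y (rim_next (Suc k) i)" if "i \<in> ?I" for i
      using that k laplacian_wheel_tilde_apply[of i k q t y] by simp
    \<comment> \<open>Index \<open>k + 2\<close> wraps around to vertex 1, so \<open>z 0\<close> is
      set to \<open>y 1\<close> separately.\<close>
    define z where "z j = (if j = 0 then y 1 else y (Suc (Suc k) - j))" for j
    have z: "z j = recurrence s (int q) w (y 1) (y (Suc k)) j" if "j \<le> Suc k" for j
    proof (rule recurrence_unique[OF _ _ _ that])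
      fix j assume j: "j + 2 \<le> Suc k"
      then have "rim_prev (Suc k) (Suc k - j) = k - j"
        "y (rim_next (Suc k) (Suc k - j)) = z j"
        by (auto simp: rim_prev_def rim_next_def z_def Suc_diff_le)
      then show "z (Suc (Suc j)) = s * z (Suc j) - int q * z j - w j"
        using xi[of "Suc k - j"] j by (simp add: z_def w_def s_def)
    qed (simp_all add: z_def)
    have "z (Suc k) = y 1" "z k = y 2" using k by (simp_all add: z_def numeral_2_eq_2)
    moreover have "x 1 = (1 + int q) * y 1 - y (Suc k) - int q * y 2"
      using xi[of 1] k by (simp add: rim_prev_def rim_next_def numeral_2_eq_2)
    ultimately have "?E1 (y (Suc k)) (y 1) \<and> ?E2 (y (Suc k)) (y 1)"
      unfolding E1 E2 using z[of k] z[of "Suc k"] by simp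
    then show "\<exists>p r. ?E1 p r \<and> ?E2 p r" by blast
  next
    assume "\<exists>p r. ?E1 p r \<and> ?E2 p r"
    then obtain p r where e1: "recurrence s (int q) w r p (Suc k) = r"
      and e2: "x 1 = (1 + int q) * r - p - int q * recurrence s (int q) w r p k"
      unfolding E1 E2 by blast
    define z where "z = recurrence s (int q) w r p"
    \<comment> \<open>Vertex 1 receives \<open>z (Suc k)\<close>, which is \<open>r = z 0\<close> by
      the closing condition \<open>e1\<close>.\<close>
    define y where "y = (\<lambda>i\<in>?I. z (Suc (Suc k) - i))"
    have y1: "y 1 = r" "y (Suc k) = p" "y 2 = z k"
      using e1 k by (auto simp: y_def z_def)
    have "x i = (\<Sum>j\<in>?I. ?L i j * y j)" if i: "i \<in> ?I" for i
    proof (cases "i = 1")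
      case True
      then show ?thesis
        using e2 k y1 unfolding laplacian_wheel_tilde_apply[OF i k]
        by (simp add: rim_prev_def rim_next_def z_def numeral_2_eq_2)
    next
      case False
      define j where "j = Suc k - i"
      have ij: "i = Suc k - j" "j < k" using False i by (auto simp: j_def)
      have "y i = z (Suc j)" "y (rim_prev (Suc k) i) = z (Suc (Suc j))"
        using ij by (auto simp: y_def rim_prev_def Suc_diff_le)
      \<comment> \<open>For \<open>j = 0\<close> the next vertex is 1, where the closing condition
        identifies \<open>y 1\<close> with \<open>z 0\<close>.\<close>
      moreover have "y (rim_next (Suc k) i) = z j"
        using ij y1 by (cases "j = 0") (auto simp: rim_next_def z_def y_def Suc_diff_le)
      moreover have "z (Suc (Suc j)) = s * z (Suc j) - int q * z j - x i"
        using ij by (simp add: z_def w_def)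
      ultimately show ?thesis
        using False unfolding laplacian_wheel_tilde_apply[OF i k] by (simp add: s_def)
    qed
    then have "x = (\<lambda>i\<in>?I. \<Sum>j\<in>?I. ?L i j * y j)"
      using x by (auto simp: carrier_int_vectors PiE_def extensional_def)
    moreover have "y \<in> carrier (int_vectors ?I)"
      by (auto simp: y_def carrier_int_vectors)
    ultimately show "x \<in> matrix_image ?I ?L" by (auto simp: matrix_image_def)
  qed
qed

section \<open>Gcd of the entries and determinant of the reduced matrix\<close>

lemma reduced_matrix_gcd:
  fixes q t :: int
  assumes "A = fundamental (1 + q + t) q"
  shows "gcd (gcd (A (Suc (Suc m))) (- (1 + q * A (Suc m))))
     (gcd (- (1 + q * A (Suc m)))
        (1 + q + q * (1 + q + t) * A (Suc m) - q * A (Suc (Suc m))))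
    = gcd t (\<Sum>i\<le>Suc m. q ^ i)"
    (is "gcd (gcd ?a (- ?b)) (gcd (- ?b) ?d) = gcd t ?Q")
proof (rule zdvd_antisym_nonneg)
  let ?u = "A (Suc m)" and ?G = "gcd (gcd ?a (- ?b)) (gcd (- ?b) ?d)"
  have a: "t dvd ?a - ?Q"
    unfolding assms by (rule fundamental_cong_geometric_sum)
  have "t dvd ?u - (\<Sum>i\<le>m. q ^ i)"
    unfolding assms by (rule fundamental_cong_geometric_sum)
  moreover have "?Q = 1 + q * (\<Sum>i\<le>m. q ^ i)"
    by (subst sum.atMost_Suc_shift) (simp add: sum_distrib_left)
  then have "?b - ?Q = q * (?u - (\<Sum>i\<le>m. q ^ i))" by (simp only: algebra_simps)
  ultimately have b: "t dvd ?b - ?Q" by simp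
  have d: "?d = (1 + q) * ?b + q * ?u * t - q * ?a" by algebra
  have G: "?G dvd ?a" "?G dvd ?b" "?G dvd ?d"
    by (meson dvd_trans gcd_dvd1 gcd_dvd2 dvd_minus_iff)+
  \<comment> \<open>The bracket is \<open>q * ?u * t\<close>, and
    \<open>q * ?u = ?b - 1\<close>.\<close>
  have "t = t * ?b - (?d + q * ?a - (1 + q) * ?b)" unfolding d by algebra
  then have Gt: "?G dvd t"
    using G by (metis dvd_add dvd_diff dvd_mult)
  have "?Q = ?a - (?a - ?Q)" by simp
  then have "?G dvd ?Q"
    using G(1) Gt a by (metis dvd_diff dvd_trans)
  with Gt show "?G dvd gcd t ?Q" by simp
  let ?g = "gcd t ?Q"
  have g: "?g dvd t" "?g dvd ?Q" by simp_all
  have "?g dvd ?a - ?Q" "?g dvd ?b - ?Q" using g(1) a b dvd_trans by blast+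
  with g(2) have "?g dvd ?a" "?g dvd ?b" by (metis diff_add_cancel dvd_add)+
  moreover from this g(1) have "?g dvd ?d"
    using dvd_diff[OF dvd_add[OF dvd_mult dvd_mult] dvd_mult] unfolding d by blast
  ultimately show "?g dvd ?G" by (simp only: gcd_greatest_iff dvd_minus_iff simp_thms)
qed simp_all

text \<open>The invariant makes the determinant linear in \<open>A\<close> up to a power of
  \<open>q\<close>; the growth bounds absorb that power and the constant and leave at least
  \<open>t * A (Suc m) > 0\<close>.\<close>

lemma reduced_matrix_det_pos:
  fixes q t :: int
  assumes "q \<ge> 0" "t \<ge> 1" and A: "A = fundamental (1 + q + t) q"
  shows "A (Suc (Suc m)) * (1 + q + q * (1 + q + t) * A (Suc m) - q * A (Suc (Suc m)))
    - (- (1 + q * A (Suc m))) * (- (1 + q * A (Suc m))) > 0"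
proof -
  let ?a = "A (Suc (Suc m))" and ?u = "A (Suc m)"
  have inv: "?a ^ 2 - (1 + q + t) * ?a * ?u + q * ?u ^ 2 = q ^ Suc m"
    unfolding A by (rule fundamental_invariant)
  have "?a * (1 + q + q * (1 + q + t) * ?u - q * ?a) - (- (1 + q * ?u)) * (- (1 + q * ?u))
      = (?a - q * ?u) + q * (?a - ?u) - q * (?a ^ 2 - (1 + q + t) * ?a * ?u + q * ?u ^ 2) - 1"
    by algebra
  also have "\<dots> = (?a - q * ?u) + q * (?a - ?u) - q * q ^ Suc m - 1"
    unfolding inv ..
  also have "\<dots> > 0"
  proof -
    have "?a - q * ?u \<ge> 1 + t * ?u" "?a - ?u \<ge> q ^ Suc m" "?u \<ge> 1"
      using fundamental_growth[OF assms(1,2), of "Suc m"] fundamental_growth[OF assms(1,2), of m]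
      by (simp_all add: A del: recurrence.simps)
    moreover from this have "q * (?a - ?u) \<ge> q * q ^ Suc m" "t * ?u > 0"
      using assms(1,2) by (simp_all add: mult_left_mono del: power_Suc)
    ultimately show ?thesis by linarith
  qed
  finally show ?thesis .
qed

section \<open>Structure of the critical group\<close>

theorem theorem11:
  fixes q t k Q d\<^sub>1 :: nat
  assumes "t \<ge> 1" and "k \<ge> 1"
    and "Q = (\<Sum>i\<le>k. q ^ i)"
    and "d\<^sub>1 = gcd t Q"
  shows "(d\<^sub>1 = 1 \<longrightarrow> cyclic_group (critical_group (wheel_tilde k q t) 0)) \<and>
    (d\<^sub>1 \<noteq> 1 \<longrightarrow> (\<exists>d\<^sub>2::nat. d\<^sub>2 > 0 \<and>
        critical_group (wheel_tilde k q t) 0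
          \<cong> integer_mod_group d\<^sub>1 \<times>\<times> integer_mod_group (d\<^sub>1 * d\<^sub>2)))"
proof -
  let ?V = "int_vectors {1..Suc k}"
  let ?im = "matrix_image {1..Suc k} (laplacian (wheel_tilde k q t))"
  define s where "s = 1 + int q + int t"
  define A where "A = fundamental s (int q)"
  define D where "D = (\<lambda>x. particular s (int q) (\<lambda>j. x (Suc k - j)))"
  define a where "a = A (Suc k)"
  define b where "b = - (1 + int q * A k)"
  define d where "d = 1 + int q + int q * s * A k - int q * A (Suc k)"
  define v1 where "v1 = (\<lambda>x. - D x (Suc k))"
  define v2 where "v2 = (\<lambda>x. x 1 + int q * D x k)"
  obtain m where m: "k = Suc m" using \<open>k \<ge> 1\<close> by (cases k) auto
  have "a * d - b * b > 0"
    using reduced_matrix_det_pos[of "int q" "int t" A m] \<open>t \<ge> 1\<close>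
    by (simp add: a_def b_def d_def A_def s_def m)
  then have det: "a * d - b * b \<noteq> 0" by simp
  have "int d\<^sub>1 = gcd (gcd a b) (gcd b d)"
    using reduced_matrix_gcd[of A "int q" "int t" m] assms(3,4)
    by (simp only: a_def b_def d_def A_def s_def m of_nat_sum of_nat_power gcd_int_int_eq[symmetric])
  then obtain x y z w d\<^sub>2 where uni: "x * w - y * z = 1" and "d\<^sub>2 > 0"
    and smith: "\<And>u1 u2. (\<exists>p r. u1 = a * p + b * r \<and> u2 = b * p + d * r) \<longleftrightarrow>
       int d\<^sub>1 dvd x * u1 + y * u2 \<and> int d\<^sub>1 * int d\<^sub>2 dvd z * u1 + w * u2"
    using smith_normal_form_2x2[OF det, of "int d\<^sub>1"] by metis
  \<comment> \<open>\<open>f\<close> and \<open>h\<close> are the Smith coordinates of the residual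
    right-hand side \<open>(v1, v2)\<close>.\<close>
  define f where "f = (\<lambda>v. x * v1 v + y * v2 v)"
  define h where "h = (\<lambda>v. z * v1 v + w * v2 v)"
  have image: "?im = {v \<in> carrier ?V. int d\<^sub>1 dvd f v \<and> int (d\<^sub>1 * d\<^sub>2) dvd h v}"
  proof -
    have "?im \<subseteq> carrier ?V" by (auto simp: matrix_image_def carrier_int_vectors)
    moreover have "v \<in> ?im \<longleftrightarrow> int d\<^sub>1 dvd f v \<and> int (d\<^sub>1 * d\<^sub>2) dvd h v"
      if "v \<in> carrier ?V" for v
      unfolding matrix_image_wheel_tilde_iff[OF \<open>k \<ge> 1\<close> that] f_def h_def of_nat_mult
        smith[symmetric] a_def b_def d_def v1_def v2_def A_def D_def s_def ..
    ultimately show ?thesis by blast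
  qed
  \<comment> \<open>Addition in \<open>?V\<close> is coordinatewise only on the index set; the bound
    on \<open>j\<close> keeps \<open>D\<close> there.\<close>
  have D_add: "D (u \<otimes>\<^bsub>?V\<^esub> v) j = D u j + D v j" if "j \<le> Suc k" for u v j
    unfolding D_def particular_add[symmetric]
    by (rule particular_cong) (use that in \<open>auto simp: mult_int_vectors\<close>)
  have add: "v1 (u \<otimes>\<^bsub>?V\<^esub> v) = v1 u + v1 v" "v2 (u \<otimes>\<^bsub>?V\<^esub> v) = v2 u + v2 v" for u v
    using D_add[of "Suc k" u v] D_add[of k u v]
    by (simp_all only: v1_def v2_def) (simp_all add: mult_int_vectors algebra_simps)
  have surj: "\<exists>v\<in>carrier ?V. v1 v = e1 \<and> v2 v = e2" for e1 e2
  proof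
    \<comment> \<open>Up to index \<open>k\<close>, \<open>D\<close> sees only coordinates from 3 on
      and vanishes; coordinate 2 first enters at \<open>Suc k\<close>, giving
      \<open>D v (Suc k) = - e1\<close>.\<close>
    define v where "v = (\<lambda>i\<in>{1..Suc k}. if i = 1 then e2 else if i = 2 then e1 else 0)"
    show "v \<in> carrier ?V" by (auto simp: v_def carrier_int_vectors)
    have D0: "D v j = 0" if "j \<le> k" for j
    proof -
      have "D v j = particular s (int q) (\<lambda>_. 0) j"
        unfolding D_def by (rule particular_cong) (use that in \<open>auto simp: v_def\<close>)
      then show ?thesis by (simp only: particular_zero)
    qed
    have "D v (Suc k) = s * D v k - int q * D v m - v 2"
      unfolding D_def m by (simp add: numeral_2_eq_2)
    moreover have "v 1 = e2" "v 2 = e1" using m by (simp_all add: v_def)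
    moreover have "D v k = 0" "D v m = 0" using m by (simp_all add: D0)
    ultimately show "v1 v = e1 \<and> v2 v = e2"
      by (simp add: v1_def v2_def)
  qed
  have fh_surj: "\<exists>v\<in>carrier ?V. f v = e1 \<and> h v = e2" for e1 e2
  proof -
    \<comment> \<open>The targets are the inverse of the unimodular matrix applied to
      \<open>(e1, e2)\<close>.\<close>
    obtain v where "v \<in> carrier ?V" "v1 v = w * e1 - y * e2" "v2 v = x * e2 - z * e1"
      using surj by blast
    moreover from this have "f v = e1" "h v = e2"
      using uni unfolding f_def h_def by algebra+
    ultimately show ?thesis by blast
  qed
  have fh_add: "f (u \<otimes>\<^bsub>?V\<^esub> v) = f u + f v" "h (u \<otimes>\<^bsub>?V\<^esub> v) = h u + h v" for u v
    unfolding f_def h_def add by algebra+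
  have "d\<^sub>1 > 0" using assms(1,4) by simp
  then have pos: "d\<^sub>1 > 0" "d\<^sub>1 * d\<^sub>2 > 0" using \<open>d\<^sub>2 > 0\<close> by simp_all
  have crit: "critical_group (wheel_tilde k q t) 0 = ?V Mod ?im"
    by (simp only: critical_group_def verts_wheel_tilde)
  have grp: "group (critical_group (wheel_tilde k q t) 0)"
    and iso: "critical_group (wheel_tilde k q t) 0
      \<cong> integer_mod_group d\<^sub>1 \<times>\<times> integer_mod_group (d\<^sub>1 * d\<^sub>2)"
    unfolding crit
    using quotient_by_congruences[OF group_int_vectors pos, of "{1..Suc k}" f h,
      OF fh_add fh_surj image]
    by auto
  have "cyclic_group (critical_group (wheel_tilde k q t) 0)" if "d\<^sub>1 = 1"
    using isomorphic_group_cyclicity[OF iso grp] that pos(2)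
      cyclic_group_trivial_times_integer_mod_group[of "d\<^sub>1 * d\<^sub>2"]
    by (simp add: DirProd_group)
  then show ?thesis using iso \<open>d\<^sub>2 > 0\<close> by blast
qed

end
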